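(* Let $E$ be a Lie-Yamaguti algebra, $\mathfrak g$ be a Lie-Yamaguti subalgebra of $E$, and $\mathfrak h$ be any strong $\mathfrak g$-complement in $E$ with the associated canonical matched pair $(\mathfrak g,\mathfrak h,(\rho,\mu),(\psi,\nu))$. Let $\mathcal{DM}(\mathfrak g,\mathfrak h)$ be the set of all deformation maps $r:\mathfrak h\to\mathfrak g$ in the canonical matched pair, and let $\sim$ be the equivalence of deformation maps. (i) $\sim$ is an equivalence relation on the set $\mathcal{DM}(\mathfrak g,\mathfrak h)$. (ii) There is a bijection between the isomorphism classes of all $\mathfrak g$-complements in $E$ and the set $\mathcal{DM}(\mathfrak g,\mathfrak h)/\sim$. In particular, the factorization index of $\mathfrak g$ in $E$ is given by $[E:\mathfrak g]^f=|\mathcal{DM}(\mathfrak g,\mathfrak h)/\sim|$.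
   Context: All vector spaces and (multi)linear maps are over a field $\mathbf k$ of characteristic $0$. **Lie-Yamaguti algebra.** A vector space $\mathfrak g$ with linear maps $[\,,]:\wedge^2\mathfrak g\to\mathfrak g$ and $\langle\,,,\rangle:\wedge^2\mathfrak g\otimes\mathfrak g\to\mathfrak g$ such that for all $x,y,z,w,t\in\mathfrak g$: $[[x,y],z]+[[y,z],x]+[[z,x],y]+\langle x,y,z\rangle+\langle y,z,x\rangle+\langle z,x,y\rangle=0$; $\langle[x,y],z,w\rangle+\langle[y,z],x,w\rangle+\langle[z,x],y,w\rangle=0$; $\langle x,y,[z,w]\rangle=[\langle x,y,z\rangle,w]+[z,\langle x,y,w\rangle]$; $\langle x,y,\langle z,w,t\rangle\rangle=\langle\langle x,y,z\rangle,w,t\rangle+\langle z,\langle x,y,w\rangle,t\rangle+\langle z,w,\langle x,y,t\rangle\rangle$. Homomorphisms are linear maps preserving both operations (isomorphisms are bijective ones); a subalgebra is a subspace closed under both operations. **Complements.** Let $(E,[\,,]_E,\langle\,,,\rangle_E)$ be a Lie-Yamaguti algebra and $\mathfrak g\subset E$ a Lie-Yamaguti subalgebra. A $\mathfrak g$-complement in $E$ is a Lie-Yamaguti subalgebra $\mathfrak h\subset E$ with $E=\mathfrak g+\mathfrak h$ and $\mathfrak g\cap\mathfrak h=\{0\}$. It is a strong $\mathfrak g$-complement if additionally $\langle\mathfrak g,\mathfrak h,\mathfrak h\rangle_E\subset\mathfrak g$ and $\langle\mathfrak h,\mathfrak g,\mathfrak g\rangle_E\subset\mathfrak h$. The restricted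 structures on $\mathfrak g$, $\mathfrak h$ are written $([\,,],\langle\,,,\rangle)$ and $([\,,]',\langle\,,,\rangle')$. Isomorphism classes of $\mathfrak g$-complements are taken with respect to isomorphism of Lie-Yamaguti algebras; the factorization index $[E:\mathfrak g]^f$ is the cardinality of the set of isomorphism classes of all $\mathfrak g$-complements in $E$. **Representation.** A representation $(V;\rho,\mu)$ of $\mathfrak g$ is a vector space $V$ with linear maps $\rho:\mathfrak g\to\mathrm{End}(V)$, $x\mapsto\rho_x$, and $\mu:\mathfrak g\otimes\mathfrak g\to\mathrm{End}(V)$ such that, with $D_{\rho,\mu}(x,y):=\rho_x\rho_y-\rho_y\rho_x-\rho_{[x,y]}-\mu(x,y)+\mu(y,x)$, for all $x,y,z,w\in\mathfrak g$: $\mu([x,y],z)=\mu(x,z)\rho_y-\mu(y,z)\rho_x$; $\mu(x,[y,z])=\rho_y\mu(x,z)-\rho_z\mu(x,y)$; $\rho_{\langle x,y,z\rangle}=D_{\rho,\mu}(x,y)\rho_z-\rho_zD_{\rho,\mu}(x,y)$; $\mu(z,w)\mu(x,y)-\mu(y,w)\mu(x,z)-\mu(x,\langle y,z,w\rangle)+D_{\rho,\mu}(y,z)\mu(x,w)=0$; $\mu(\langle x,y,z\rangle,w)+\mu(z,\langle x,y,w\rangle)=D_{\rho,\mu}(x,y)\mu(z,w)-\mu(z,w)D_{\rho,\mu}(x,y)$. **Matched pair.** A matched pair of Lie-Yamaguti algebras $(\mathfrak g,\mathfrak h,(\rho,\mu),(\psi,\nu))$ consists of Lie-Yamaguti algebras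 $(\mathfrak g,[\,,],\langle\,,,\rangle)$, $(\mathfrak h,[\,,]',\langle\,,,\rangle')$ and linear maps $\rho:\mathfrak g\to\mathrm{End}(\mathfrak h)$, $\mu:\mathfrak g\otimes\mathfrak g\to\mathrm{End}(\mathfrak h)$, $\psi:\mathfrak h\to\mathrm{End}(\mathfrak g)$, $\nu:\mathfrak h\otimes\mathfrak h\to\mathrm{End}(\mathfrak g)$ such that $(\mathfrak h;\rho,\mu)$ is a representation of $\mathfrak g$, $(\mathfrak g;\psi,\nu)$ is a representation of $\mathfrak h$, and for all $x,y,z\in\mathfrak g$, $\alpha,\beta,\gamma\in\mathfrak h$: (1) $\rho_x([\alpha,\beta]')=[\rho_x\alpha,\beta]'+[\alpha,\rho_x\beta]'+\rho_{\psi_\beta x}\alpha-\rho_{\psi_\alpha x}\beta$; (2) $\rho_x(\langle\alpha,\beta,\gamma\rangle')=\langle\alpha,\beta,\rho_x\gamma\rangle'-\rho_{D_{\psi,\nu}(\alpha,\beta)x}\gamma$; (3) $\langle\rho_x\alpha,\beta,\gamma\rangle'+\langle\alpha,\rho_x\beta,\gamma\rangle'=0$; (4) $\rho_{\nu(\alpha,\beta)x}\gamma=\rho_{\nu(\alpha,\gamma)x}\beta$; (5) $\mu(x,y)([\alpha,\beta]')=\mu(\psi_\beta x,y)\alpha-\mu(\psi_\alpha x,y)\beta$; (6) $\mu(x,y)\langle\alpha,\beta,\gamma\rangle'=\langle\alpha,\beta,\mu(x,y)\gamma\rangle'-\mu(D_{\psi,\nu}(\alpha,\beta)x,y)\gamma-\mu(x,D_{\psi,\nu}(\alpha,\beta)y)\gamma$;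 (7) $\mu(x,\psi_\alpha y)\beta=[\alpha,\mu(x,y)\beta]'$; (8) $\mu(\nu(\alpha,\beta)x,y)\gamma-\mu(\nu(\alpha,\gamma)x,y)\beta=\mu(x,D_{\psi,\nu}(\beta,\gamma)y)\alpha-\langle\beta,\gamma,\mu(x,y)\alpha\rangle'$; (9) $\mu(x,\nu(\alpha,\beta)y)\gamma=\langle\mu(x,y)\gamma,\alpha,\beta\rangle'-D_{\rho,\mu}(y,\nu(\gamma,\alpha)x)\beta+\mu(y,\nu(\gamma,\beta)x)\alpha$; (10) $\psi_\alpha([x,y])=[\psi_\alpha x,y]+[x,\psi_\alpha y]+\psi_{\rho_y\alpha}x-\psi_{\rho_x\alpha}y$; (11) $\psi_\alpha(\langle x,y,z\rangle)=\langle x,y,\psi_\alpha z\rangle-\psi_{D_{\rho,\mu}(x,y)\alpha}z$; (12) $\langle\psi_\alpha x,y,z\rangle+\langle x,\psi_\alpha y,z\rangle=0$; (13) $\psi_{\mu(x,y)\alpha}z=\psi_{\mu(x,z)\alpha}y$; (14) $\nu(\alpha,\beta)([x,y])=\nu(\rho_y\alpha,\beta)x-\nu(\rho_x\alpha,\beta)y$; (15) $\nu(\alpha,\beta)\langle x,y,z\rangle=\langle x,y,\nu(\alpha,\beta)z\rangle-\nu(D_{\rho,\mu}(x,y)\alpha,\beta)z-\nu(\alpha,D_{\rho,\mu}(x,y)\beta)z$; (16) $\nu(\alpha,\rho_x\beta)y=[x,\nu(\alpha,\beta)y]$; (17) $\nu(\mu(x,y)\alpha,\beta)z-\nu(\mu(x,z)\alpha,\beta)y=\nu(\alpha,D_{\rho,\mu}(y,z)\beta)x-\langle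 y,z,\nu(\alpha,\beta)x\rangle$; (18) $\nu(\alpha,\mu(x,y)\beta)z=\langle\nu(\alpha,\beta)z,x,y\rangle-D_{\psi,\nu}(\beta,\mu(z,x)\alpha)y+\nu(\beta,\mu(z,y)\alpha)x$. **Bicrossed product.** $\mathfrak g\bowtie\mathfrak h$ is the Lie-Yamaguti algebra on $\mathfrak g\oplus\mathfrak h$ with operations $[(x,\alpha),(y,\beta)]_{\bowtie}=([x,y]+\psi_\alpha y-\psi_\beta x,\ [\alpha,\beta]'+\rho_x\beta-\rho_y\alpha)$, $\langle(x,\alpha),(y,\beta),(z,\gamma)\rangle_{\bowtie}=(\langle x,y,z\rangle+D_{\psi,\nu}(\alpha,\beta)z+\nu(\beta,\gamma)x-\nu(\alpha,\gamma)y,\ \langle\alpha,\beta,\gamma\rangle'+D_{\rho,\mu}(x,y)\gamma+\mu(y,z)\alpha-\mu(x,z)\beta)$. (It is known that this is a Lie-Yamaguti algebra.) **Canonical matched pair.** For a strong $\mathfrak g$-complement $\mathfrak h$ in $E$, write elements of $E$ uniquely as pairs $(x,\alpha)=x+\alpha$ with $x\in\mathfrak g$, $\alpha\in\mathfrak h$. The canonical matched pair $(\mathfrak g,\mathfrak h,(\rho,\mu),(\psi,\nu))$ is the matched pair determined by $[(x,0),(0,\alpha)]_E=(-\psi_\alpha x,\rho_x\alpha)$, $\langle(0,\alpha),(x,0),(y,0)\rangle_E=(0,\mu(x,y)\alpha)$, $\langle(x,0),(0,\alpha),(0,\beta)\rangle_E=(\nu(\alpha,\beta)x,0)$, under which $E$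 is identified with $\mathfrak g\bowtie\mathfrak h$ as a Lie-Yamaguti algebra via $x+\alpha\leftrightarrow(x,\alpha)$. **Deformation map.** A linear map $r:\mathfrak h\to\mathfrak g$ is a deformation map in the matched pair if for all $\alpha,\beta,\gamma\in\mathfrak h$: $[r(\alpha),r(\beta)]+\psi_\alpha r(\beta)-\psi_\beta r(\alpha)=r([\alpha,\beta]'+\rho_{r(\alpha)}\beta-\rho_{r(\beta)}\alpha)$, and $\langle r(\alpha),r(\beta),r(\gamma)\rangle+D_{\psi,\nu}(\alpha,\beta)r(\gamma)+\nu(\beta,\gamma)r(\alpha)-\nu(\alpha,\gamma)r(\beta)=r(\langle\alpha,\beta,\gamma\rangle'+D_{\rho,\mu}(r(\alpha),r(\beta))\gamma+\mu(r(\beta),r(\gamma))\alpha-\mu(r(\alpha),r(\gamma))\beta)$. **Equivalence.** Two deformation maps $r,r':\mathfrak h\to\mathfrak g$ are equivalent, $r\sim r'$, if there exists a linear isomorphism $\sigma:\mathfrak h\to\mathfrak h$ such that for all $\alpha,\beta,\gamma\in\mathfrak h$: $\sigma([\alpha,\beta]')-[\sigma(\alpha),\sigma(\beta)]'=\rho_{r'(\sigma(\alpha))}\sigma(\beta)-\rho_{r'(\sigma(\beta))}\sigma(\alpha)-\sigma(\rho_{r(\alpha)}\beta-\rho_{r(\beta)}\alpha)$, and $\sigma(\langle\alpha,\beta,\gamma\rangle')-\langle\sigma(\alpha),\sigma(\beta),\sigma(\gamma)\rangle'=D_{\rho,\mu}(r'(\sigma(\alpha)),r'(\sigma(\beta)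))\sigma(\gamma)+\mu(r'(\sigma(\beta)),r'(\sigma(\gamma)))\sigma(\alpha)-\mu(r'(\sigma(\alpha)),r'(\sigma(\gamma)))\sigma(\beta)-\sigma\big(D_{\rho,\mu}(r(\alpha),r(\beta))\gamma+\mu(r(\beta),r(\gamma))\alpha-\mu(r(\alpha),r(\gamma))\beta\big)$.
   Formalization: The formal theorem assumes that the maps ρ, μ, ψ, ν determined by the strong complement 𝔥 really form a matched pair; this fails for some strong complements (e.g. when ⟨𝔥,𝔥,𝔤⟩ is not contained in 𝔤), and then the canonical matched pair does not exist. *)

theory Defs
  imports Complex_Main "HOL-Library.FuncSet"
begin

text \<open>
  Subalgebras and complements live inside one ambient algebra, so all structures are given by a
  carrier subset of a type together with operations on that type. Axioms constrain the operations
  on the carrier only.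
\<close>

definition linear_map_on ::
  "('k \<Rightarrow> 'a \<Rightarrow> 'a::ab_group_add) \<Rightarrow> 'a set \<Rightarrow> ('k \<Rightarrow> 'b \<Rightarrow> 'b::ab_group_add) \<Rightarrow> 'b set
    \<Rightarrow> ('a \<Rightarrow> 'b) \<Rightarrow> bool" where
  "linear_map_on s1 V s2 W f \<longleftrightarrow>
     f \<in> V \<rightarrow> W \<and>
     (\<forall>u\<in>V. \<forall>v\<in>V. f (u + v) = f u + f v) \<and>
     (\<forall>c. \<forall>v\<in>V. f (s1 c v) = s2 c (f v))"

locale lie_yamaguti_algebra = vector_space scale
  for scale :: "'k::field_char_0 \<Rightarrow> 'a::ab_group_add \<Rightarrow> 'a" +
  fixes L :: "'a set"
    and br :: "'a \<Rightarrow> 'a \<Rightarrow> 'a"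
    and tri :: "'a \<Rightarrow> 'a \<Rightarrow> 'a \<Rightarrow> 'a"
  assumes carrier_subspace: "subspace L"
    and br_linear1: "y \<in> L \<Longrightarrow> linear_map_on scale L scale L (\<lambda>x. br x y)"
    and br_linear2: "x \<in> L \<Longrightarrow> linear_map_on scale L scale L (\<lambda>y. br x y)"
    and br_alternating: "x \<in> L \<Longrightarrow> br x x = 0"
    and tri_linear1: "\<lbrakk>y \<in> L; z \<in> L\<rbrakk> \<Longrightarrow> linear_map_on scale L scale L (\<lambda>x. tri x y z)"
    and tri_linear2: "\<lbrakk>x \<in> L; z \<in> L\<rbrakk> \<Longrightarrow> linear_map_on scale L scale L (\<lambda>y. tri x y z)"
    and tri_linear3: "\<lbrakk>x \<in> L; y \<in> L\<rbrakk> \<Longrightarrow> linear_map_on scale L scale L (\<lambda>z. tri x y z)"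
    and tri_alternating: "\<lbrakk>x \<in> L; z \<in> L\<rbrakk> \<Longrightarrow> tri x x z = 0"
    and ly1: "\<lbrakk>x \<in> L; y \<in> L; z \<in> L\<rbrakk> \<Longrightarrow>
      br (br x y) z + br (br y z) x + br (br z x) y + tri x y z + tri y z x + tri z x y = 0"
    and ly2: "\<lbrakk>x \<in> L; y \<in> L; z \<in> L; w \<in> L\<rbrakk> \<Longrightarrow>
      tri (br x y) z w + tri (br y z) x w + tri (br z x) y w = 0"
    and ly3: "\<lbrakk>x \<in> L; y \<in> L; z \<in> L; w \<in> L\<rbrakk> \<Longrightarrow>
      tri x y (br z w) = br (tri x y z) w + br z (tri x y w)"
    and ly4: "\<lbrakk>x \<in> L; y \<in> L; z \<in> L; w \<in> L; t \<in> L\<rbrakk> \<Longrightarrow>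
      tri x y (tri z w t) = tri (tri x y z) w t + tri z (tri x y w) t + tri z w (tri x y t)"

definition ly_subalgebra ::
  "('k::field_char_0 \<Rightarrow> 'a::ab_group_add \<Rightarrow> 'a) \<Rightarrow> 'a set \<Rightarrow> ('a \<Rightarrow> 'a \<Rightarrow> 'a)
    \<Rightarrow> ('a \<Rightarrow> 'a \<Rightarrow> 'a \<Rightarrow> 'a) \<Rightarrow> 'a set \<Rightarrow> bool" where
  "ly_subalgebra scale E br tri g \<longleftrightarrow>
     g \<subseteq> E \<and> module.subspace scale g \<and>
     (\<forall>x\<in>g. \<forall>y\<in>g. br x y \<in> g) \<and>
     (\<forall>x\<in>g. \<forall>y\<in>g. \<forall>z\<in>g. tri x y z \<in> g)"

definition ly_isomorphism ::
  "('k \<Rightarrow> 'a::ab_group_add \<Rightarrow> 'a) \<Rightarrow> 'a set \<Rightarrow> ('a \<Rightarrow> 'a \<Rightarrow> 'a) \<Rightarrow> ('a \<Rightarrow> 'a \<Rightarrow> 'a \<Rightarrow> 'a)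
    \<Rightarrow> ('k \<Rightarrow> 'b::ab_group_add \<Rightarrow> 'b) \<Rightarrow> 'b set \<Rightarrow> ('b \<Rightarrow> 'b \<Rightarrow> 'b) \<Rightarrow> ('b \<Rightarrow> 'b \<Rightarrow> 'b \<Rightarrow> 'b)
    \<Rightarrow> ('a \<Rightarrow> 'b) \<Rightarrow> bool" where
  "ly_isomorphism s1 L1 br1 tri1 s2 L2 br2 tri2 f \<longleftrightarrow>
     linear_map_on s1 L1 s2 L2 f \<and> bij_betw f L1 L2 \<and>
     (\<forall>x\<in>L1. \<forall>y\<in>L1. f (br1 x y) = br2 (f x) (f y)) \<and>
     (\<forall>x\<in>L1. \<forall>y\<in>L1. \<forall>z\<in>L1. f (tri1 x y z) = tri2 (f x) (f y) (f z))"

definition ly_complement ::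
  "('k::field_char_0 \<Rightarrow> 'a::ab_group_add \<Rightarrow> 'a) \<Rightarrow> 'a set \<Rightarrow> ('a \<Rightarrow> 'a \<Rightarrow> 'a)
    \<Rightarrow> ('a \<Rightarrow> 'a \<Rightarrow> 'a \<Rightarrow> 'a) \<Rightarrow> 'a set \<Rightarrow> 'a set \<Rightarrow> bool" where
  "ly_complement scale E br tri g h \<longleftrightarrow>
     ly_subalgebra scale E br tri h \<and>
     E = {x + \<alpha> |x \<alpha>. x \<in> g \<and> \<alpha> \<in> h} \<and> g \<inter> h = {0}"

definition ly_strong_complement ::
  "('k::field_char_0 \<Rightarrow> 'a::ab_group_add \<Rightarrow> 'a) \<Rightarrow> 'a set \<Rightarrow> ('a \<Rightarrow> 'a \<Rightarrow> 'a)
    \<Rightarrow> ('a \<Rightarrow> 'a \<Rightarrow> 'a \<Rightarrow> 'a) \<Rightarrow> 'a set \<Rightarrow> 'a set \<Rightarrow> bool" where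
  "ly_strong_complement scale E br tri g h \<longleftrightarrow>
     ly_complement scale E br tri g h \<and>
     (\<forall>x\<in>g. \<forall>\<alpha>\<in>h. \<forall>\<beta>\<in>h. tri x \<alpha> \<beta> \<in> g) \<and>
     (\<forall>\<alpha>\<in>h. \<forall>x\<in>g. \<forall>y\<in>g. tri \<alpha> x y \<in> h)"

definition ly_complement_iso ::
  "('k::field_char_0 \<Rightarrow> 'a::ab_group_add \<Rightarrow> 'a) \<Rightarrow> 'a set \<Rightarrow> ('a \<Rightarrow> 'a \<Rightarrow> 'a)
    \<Rightarrow> ('a \<Rightarrow> 'a \<Rightarrow> 'a \<Rightarrow> 'a) \<Rightarrow> 'a set \<Rightarrow> ('a set \<times> 'a set) set" where
  "ly_complement_iso scale E br tri g =
     {(h, h'). ly_complement scale E br tri g h \<and> ly_complement scale E br tri g h' \<and>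
        (\<exists>f. ly_isomorphism scale h br tri scale h' br tri f)}"

definition ly_complement_classes ::
  "('k::field_char_0 \<Rightarrow> 'a::ab_group_add \<Rightarrow> 'a) \<Rightarrow> 'a set \<Rightarrow> ('a \<Rightarrow> 'a \<Rightarrow> 'a)
    \<Rightarrow> ('a \<Rightarrow> 'a \<Rightarrow> 'a \<Rightarrow> 'a) \<Rightarrow> 'a set \<Rightarrow> 'a set set set" where
  "ly_complement_classes scale E br tri g =
     {h. ly_complement scale E br tri g h} // ly_complement_iso scale E br tri g"

text \<open>
  The index may be infinite, so it is a cardinal in the sense of \<^const>\<open>card_of\<close>
  (compared by \<^const>\<open>ordIso\<close>) rather than a natural number.
\<close>

definition factorization_index ::
  "('k::field_char_0 \<Rightarrow> 'a::ab_group_add \<Rightarrow> 'a) \<Rightarrow> 'a set \<Rightarrow> ('a \<Rightarrow> 'a \<Rightarrow> 'a)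
    \<Rightarrow> ('a \<Rightarrow> 'a \<Rightarrow> 'a \<Rightarrow> 'a) \<Rightarrow> 'a set \<Rightarrow> 'a set set rel" where
  "factorization_index scale E br tri g = card_of (ly_complement_classes scale E br tri g)"

definition rep_D ::
  "('a \<Rightarrow> 'a \<Rightarrow> 'a) \<Rightarrow> ('a \<Rightarrow> 'b \<Rightarrow> 'b::ab_group_add) \<Rightarrow> ('a \<Rightarrow> 'a \<Rightarrow> 'b \<Rightarrow> 'b)
    \<Rightarrow> 'a \<Rightarrow> 'a \<Rightarrow> 'b \<Rightarrow> 'b" where
  "rep_D br \<rho> \<mu> x y v =
     \<rho> x (\<rho> y v) - \<rho> y (\<rho> x v) - \<rho> (br x y) v - \<mu> x y v + \<mu> y x v"

locale ly_representation =
  lie_yamaguti_algebra scale L br tri + V: vector_space scaleV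
  for scale :: "'k::field_char_0 \<Rightarrow> 'a::ab_group_add \<Rightarrow> 'a"
    and L br tri
    and scaleV :: "'k \<Rightarrow> 'b::ab_group_add \<Rightarrow> 'b" +
  fixes V :: "'b set"
    and \<rho> :: "'a \<Rightarrow> 'b \<Rightarrow> 'b"
    and \<mu> :: "'a \<Rightarrow> 'a \<Rightarrow> 'b \<Rightarrow> 'b"
  assumes rep_subspace: "V.subspace V"
    and rho_End: "x \<in> L \<Longrightarrow> linear_map_on scaleV V scaleV V (\<rho> x)"
    and rho_linear: "v \<in> V \<Longrightarrow> linear_map_on scale L scaleV V (\<lambda>x. \<rho> x v)"
    and mu_End: "\<lbrakk>x \<in> L; y \<in> L\<rbrakk> \<Longrightarrow> linear_map_on scaleV V scaleV V (\<mu> x y)"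
    and mu_linear1: "\<lbrakk>y \<in> L; v \<in> V\<rbrakk> \<Longrightarrow> linear_map_on scale L scaleV V (\<lambda>x. \<mu> x y v)"
    and mu_linear2: "\<lbrakk>x \<in> L; v \<in> V\<rbrakk> \<Longrightarrow> linear_map_on scale L scaleV V (\<lambda>y. \<mu> x y v)"
    and rep1: "\<lbrakk>x \<in> L; y \<in> L; z \<in> L; v \<in> V\<rbrakk> \<Longrightarrow>
      \<mu> (br x y) z v = \<mu> x z (\<rho> y v) - \<mu> y z (\<rho> x v)"
    and rep2: "\<lbrakk>x \<in> L; y \<in> L; z \<in> L; v \<in> V\<rbrakk> \<Longrightarrow>
      \<mu> x (br y z) v = \<rho> y (\<mu> x z v) - \<rho> z (\<mu> x y v)"
    and rep3: "\<lbrakk>x \<in> L; y \<in> L; z \<in> L; v \<in> V\<rbrakk> \<Longrightarrow>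
      \<rho> (tri x y z) v = rep_D br \<rho> \<mu> x y (\<rho> z v) - \<rho> z (rep_D br \<rho> \<mu> x y v)"
    and rep4: "\<lbrakk>x \<in> L; y \<in> L; z \<in> L; w \<in> L; v \<in> V\<rbrakk> \<Longrightarrow>
      \<mu> z w (\<mu> x y v) - \<mu> y w (\<mu> x z v) - \<mu> x (tri y z w) v
        + rep_D br \<rho> \<mu> y z (\<mu> x w v) = 0"
    and rep5: "\<lbrakk>x \<in> L; y \<in> L; z \<in> L; w \<in> L; v \<in> V\<rbrakk> \<Longrightarrow>
      \<mu> (tri x y z) w v + \<mu> z (tri x y w) v
        = rep_D br \<rho> \<mu> x y (\<mu> z w v) - \<mu> z w (rep_D br \<rho> \<mu> x y v)"

locale ly_matched_pair =
  G: ly_representation sg g br tri sh h \<rho> \<mu> +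
  H: ly_representation sh h br' tri' sg g \<psi> \<nu>
  for sg :: "'k::field_char_0 \<Rightarrow> 'a::ab_group_add \<Rightarrow> 'a" and g br tri
    and sh :: "'k \<Rightarrow> 'b::ab_group_add \<Rightarrow> 'b" and h br' tri'
    and \<rho> \<mu> \<psi> \<nu> +
  assumes mp1: "\<lbrakk>x \<in> g; \<alpha> \<in> h; \<beta> \<in> h\<rbrakk> \<Longrightarrow>
      \<rho> x (br' \<alpha> \<beta>) = br' (\<rho> x \<alpha>) \<beta> + br' \<alpha> (\<rho> x \<beta>) + \<rho> (\<psi> \<beta> x) \<alpha> - \<rho> (\<psi> \<alpha> x) \<beta>"
    and mp2: "\<lbrakk>x \<in> g; \<alpha> \<in> h; \<beta> \<in> h; \<gamma> \<in> h\<rbrakk> \<Longrightarrow>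
      \<rho> x (tri' \<alpha> \<beta> \<gamma>) = tri' \<alpha> \<beta> (\<rho> x \<gamma>) - \<rho> (rep_D br' \<psi> \<nu> \<alpha> \<beta> x) \<gamma>"
    and mp3: "\<lbrakk>x \<in> g; \<alpha> \<in> h; \<beta> \<in> h; \<gamma> \<in> h\<rbrakk> \<Longrightarrow>
      tri' (\<rho> x \<alpha>) \<beta> \<gamma> + tri' \<alpha> (\<rho> x \<beta>) \<gamma> = 0"
    and mp4: "\<lbrakk>x \<in> g; \<alpha> \<in> h; \<beta> \<in> h; \<gamma> \<in> h\<rbrakk> \<Longrightarrow>
      \<rho> (\<nu> \<alpha> \<beta> x) \<gamma> = \<rho> (\<nu> \<alpha> \<gamma> x) \<beta>"
    and mp5: "\<lbrakk>x \<in> g; y \<in> g; \<alpha> \<in> h; \<beta> \<in> h\<rbrakk> \<Longrightarrow>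
      \<mu> x y (br' \<alpha> \<beta>) = \<mu> (\<psi> \<beta> x) y \<alpha> - \<mu> (\<psi> \<alpha> x) y \<beta>"
    and mp6: "\<lbrakk>x \<in> g; y \<in> g; \<alpha> \<in> h; \<beta> \<in> h; \<gamma> \<in> h\<rbrakk> \<Longrightarrow>
      \<mu> x y (tri' \<alpha> \<beta> \<gamma>) = tri' \<alpha> \<beta> (\<mu> x y \<gamma>)
        - \<mu> (rep_D br' \<psi> \<nu> \<alpha> \<beta> x) y \<gamma> - \<mu> x (rep_D br' \<psi> \<nu> \<alpha> \<beta> y) \<gamma>"
    and mp7: "\<lbrakk>x \<in> g; y \<in> g; \<alpha> \<in> h; \<beta> \<in> h\<rbrakk> \<Longrightarrow>
      \<mu> x (\<psi> \<alpha> y) \<beta> = br' \<alpha> (\<mu> x y \<beta>)"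
    and mp8: "\<lbrakk>x \<in> g; y \<in> g; \<alpha> \<in> h; \<beta> \<in> h; \<gamma> \<in> h\<rbrakk> \<Longrightarrow>
      \<mu> (\<nu> \<alpha> \<beta> x) y \<gamma> - \<mu> (\<nu> \<alpha> \<gamma> x) y \<beta>
        = \<mu> x (rep_D br' \<psi> \<nu> \<beta> \<gamma> y) \<alpha> - tri' \<beta> \<gamma> (\<mu> x y \<alpha>)"
    and mp9: "\<lbrakk>x \<in> g; y \<in> g; \<alpha> \<in> h; \<beta> \<in> h; \<gamma> \<in> h\<rbrakk> \<Longrightarrow>
      \<mu> x (\<nu> \<alpha> \<beta> y) \<gamma> = tri' (\<mu> x y \<gamma>) \<alpha> \<beta>
        - rep_D br \<rho> \<mu> y (\<nu> \<gamma> \<alpha> x) \<beta> + \<mu> y (\<nu> \<gamma> \<beta> x) \<alpha>"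
    and mp10: "\<lbrakk>\<alpha> \<in> h; x \<in> g; y \<in> g\<rbrakk> \<Longrightarrow>
      \<psi> \<alpha> (br x y) = br (\<psi> \<alpha> x) y + br x (\<psi> \<alpha> y) + \<psi> (\<rho> y \<alpha>) x - \<psi> (\<rho> x \<alpha>) y"
    and mp11: "\<lbrakk>\<alpha> \<in> h; x \<in> g; y \<in> g; z \<in> g\<rbrakk> \<Longrightarrow>
      \<psi> \<alpha> (tri x y z) = tri x y (\<psi> \<alpha> z) - \<psi> (rep_D br \<rho> \<mu> x y \<alpha>) z"
    and mp12: "\<lbrakk>\<alpha> \<in> h; x \<in> g; y \<in> g; z \<in> g\<rbrakk> \<Longrightarrow>
      tri (\<psi> \<alpha> x) y z + tri x (\<psi> \<alpha> y) z = 0"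
    and mp13: "\<lbrakk>\<alpha> \<in> h; x \<in> g; y \<in> g; z \<in> g\<rbrakk> \<Longrightarrow>
      \<psi> (\<mu> x y \<alpha>) z = \<psi> (\<mu> x z \<alpha>) y"
    and mp14: "\<lbrakk>\<alpha> \<in> h; \<beta> \<in> h; x \<in> g; y \<in> g\<rbrakk> \<Longrightarrow>
      \<nu> \<alpha> \<beta> (br x y) = \<nu> (\<rho> y \<alpha>) \<beta> x - \<nu> (\<rho> x \<alpha>) \<beta> y"
    and mp15: "\<lbrakk>\<alpha> \<in> h; \<beta> \<in> h; x \<in> g; y \<in> g; z \<in> g\<rbrakk> \<Longrightarrow>
      \<nu> \<alpha> \<beta> (tri x y z) = tri x y (\<nu> \<alpha> \<beta> z)
        - \<nu> (rep_D br \<rho> \<mu> x y \<alpha>) \<beta> z - \<nu> \<alpha> (rep_D br \<rho> \<mu> x y \<beta>) z"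
    and mp16: "\<lbrakk>\<alpha> \<in> h; \<beta> \<in> h; x \<in> g; y \<in> g\<rbrakk> \<Longrightarrow>
      \<nu> \<alpha> (\<rho> x \<beta>) y = br x (\<nu> \<alpha> \<beta> y)"
    and mp17: "\<lbrakk>\<alpha> \<in> h; \<beta> \<in> h; x \<in> g; y \<in> g; z \<in> g\<rbrakk> \<Longrightarrow>
      \<nu> (\<mu> x y \<alpha>) \<beta> z - \<nu> (\<mu> x z \<alpha>) \<beta> y
        = \<nu> \<alpha> (rep_D br \<rho> \<mu> y z \<beta>) x - tri y z (\<nu> \<alpha> \<beta> x)"
    and mp18: "\<lbrakk>\<alpha> \<in> h; \<beta> \<in> h; x \<in> g; y \<in> g; z \<in> g\<rbrakk> \<Longrightarrow>
      \<nu> \<alpha> (\<mu> x y \<beta>) z = tri (\<nu> \<alpha> \<beta> z) x y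
        - rep_D br' \<psi> \<nu> \<beta> (\<mu> z x \<alpha>) y + \<nu> \<beta> (\<mu> z y \<alpha>) x"

text \<open>
  Being a matched pair is part of the definition: for an arbitrary strong complement \<open>h\<close> the maps
  determined by the four equations need not satisfy the matched pair axioms. When they do,
  \<open>x + \<alpha> \<mapsto> (x, \<alpha>)\<close> identifies the ambient algebra with the bicrossed product, since the
  remaining mixed values, those of \<open>tri x y \<alpha>\<close> and \<open>tri \<alpha> \<beta> x\<close>, follow from \<open>ly1\<close>, \<open>mp1\<close>
  and \<open>mp10\<close>.
\<close>

definition canonical_matched_pair ::
  "('k::field_char_0 \<Rightarrow> 'a::ab_group_add \<Rightarrow> 'a) \<Rightarrow> ('a \<Rightarrow> 'a \<Rightarrow> 'a) \<Rightarrow> ('a \<Rightarrow> 'a \<Rightarrow> 'a \<Rightarrow> 'a)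
    \<Rightarrow> 'a set \<Rightarrow> 'a set \<Rightarrow> ('a \<Rightarrow> 'a \<Rightarrow> 'a) \<Rightarrow> ('a \<Rightarrow> 'a \<Rightarrow> 'a \<Rightarrow> 'a)
    \<Rightarrow> ('a \<Rightarrow> 'a \<Rightarrow> 'a) \<Rightarrow> ('a \<Rightarrow> 'a \<Rightarrow> 'a \<Rightarrow> 'a) \<Rightarrow> bool" where
  "canonical_matched_pair scale br tri g h \<rho> \<mu> \<psi> \<nu> \<longleftrightarrow>
     ly_matched_pair scale g br tri scale h br tri \<rho> \<mu> \<psi> \<nu> \<and>
     (\<forall>x\<in>g. \<forall>\<alpha>\<in>h. br x \<alpha> = - \<psi> \<alpha> x + \<rho> x \<alpha>) \<and>
     (\<forall>\<alpha>\<in>h. \<forall>x\<in>g. \<forall>y\<in>g. tri \<alpha> x y = \<mu> x y \<alpha>) \<and>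
     (\<forall>x\<in>g. \<forall>\<alpha>\<in>h. \<forall>\<beta>\<in>h. tri x \<alpha> \<beta> = \<nu> \<alpha> \<beta> x)"

text \<open>
  Deformation maps are required to be \<^const>\<open>extensional\<close> so that a map
  on \<open>h\<close> is represented by exactly one function on the type.
\<close>

definition deformation_maps ::
  "('k \<Rightarrow> 'a::ab_group_add \<Rightarrow> 'a) \<Rightarrow> 'a set \<Rightarrow> ('a \<Rightarrow> 'a \<Rightarrow> 'a) \<Rightarrow> ('a \<Rightarrow> 'a \<Rightarrow> 'a \<Rightarrow> 'a)
    \<Rightarrow> ('k \<Rightarrow> 'b::ab_group_add \<Rightarrow> 'b) \<Rightarrow> 'b set \<Rightarrow> ('b \<Rightarrow> 'b \<Rightarrow> 'b) \<Rightarrow> ('b \<Rightarrow> 'b \<Rightarrow> 'b \<Rightarrow> 'b)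
    \<Rightarrow> ('a \<Rightarrow> 'b \<Rightarrow> 'b) \<Rightarrow> ('a \<Rightarrow> 'a \<Rightarrow> 'b \<Rightarrow> 'b)
    \<Rightarrow> ('b \<Rightarrow> 'a \<Rightarrow> 'a) \<Rightarrow> ('b \<Rightarrow> 'b \<Rightarrow> 'a \<Rightarrow> 'a) \<Rightarrow> ('b \<Rightarrow> 'a) set" where
  "deformation_maps sg g br tri sh h br' tri' \<rho> \<mu> \<psi> \<nu> =
     {r. r \<in> extensional h \<and> linear_map_on sh h sg g r \<and>
        (\<forall>\<alpha>\<in>h. \<forall>\<beta>\<in>h.
           br (r \<alpha>) (r \<beta>) + \<psi> \<alpha> (r \<beta>) - \<psi> \<beta> (r \<alpha>)
           = r (br' \<alpha> \<beta> + \<rho> (r \<alpha>) \<beta> - \<rho> (r \<beta>) \<alpha>)) \<and>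
        (\<forall>\<alpha>\<in>h. \<forall>\<beta>\<in>h. \<forall>\<gamma>\<in>h.
           tri (r \<alpha>) (r \<beta>) (r \<gamma>) + rep_D br' \<psi> \<nu> \<alpha> \<beta> (r \<gamma>) + \<nu> \<beta> \<gamma> (r \<alpha>) - \<nu> \<alpha> \<gamma> (r \<beta>)
           = r (tri' \<alpha> \<beta> \<gamma> + rep_D br \<rho> \<mu> (r \<alpha>) (r \<beta>) \<gamma>
                + \<mu> (r \<beta>) (r \<gamma>) \<alpha> - \<mu> (r \<alpha>) (r \<gamma>) \<beta>))}"

definition deformation_equiv ::
  "('a::ab_group_add \<Rightarrow> 'a \<Rightarrow> 'a)
    \<Rightarrow> ('k \<Rightarrow> 'b::ab_group_add \<Rightarrow> 'b) \<Rightarrow> 'b set \<Rightarrow> ('b \<Rightarrow> 'b \<Rightarrow> 'b) \<Rightarrow> ('b \<Rightarrow> 'b \<Rightarrow> 'b \<Rightarrow> 'b)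
    \<Rightarrow> ('a \<Rightarrow> 'b \<Rightarrow> 'b) \<Rightarrow> ('a \<Rightarrow> 'a \<Rightarrow> 'b \<Rightarrow> 'b) \<Rightarrow> ('b \<Rightarrow> 'a) \<Rightarrow> ('b \<Rightarrow> 'a) \<Rightarrow> bool" where
  "deformation_equiv br sh h br' tri' \<rho> \<mu> r r' \<longleftrightarrow>
     (\<exists>\<sigma>. linear_map_on sh h sh h \<sigma> \<and> bij_betw \<sigma> h h \<and>
        (\<forall>\<alpha>\<in>h. \<forall>\<beta>\<in>h.
           \<sigma> (br' \<alpha> \<beta>) - br' (\<sigma> \<alpha>) (\<sigma> \<beta>)
           = \<rho> (r' (\<sigma> \<alpha>)) (\<sigma> \<beta>) - \<rho> (r' (\<sigma> \<beta>)) (\<sigma> \<alpha>)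
             - \<sigma> (\<rho> (r \<alpha>) \<beta> - \<rho> (r \<beta>) \<alpha>)) \<and>
        (\<forall>\<alpha>\<in>h. \<forall>\<beta>\<in>h. \<forall>\<gamma>\<in>h.
           \<sigma> (tri' \<alpha> \<beta> \<gamma>) - tri' (\<sigma> \<alpha>) (\<sigma> \<beta>) (\<sigma> \<gamma>)
           = rep_D br \<rho> \<mu> (r' (\<sigma> \<alpha>)) (r' (\<sigma> \<beta>)) (\<sigma> \<gamma>)
             + \<mu> (r' (\<sigma> \<beta>)) (r' (\<sigma> \<gamma>)) (\<sigma> \<alpha>) - \<mu> (r' (\<sigma> \<alpha>)) (r' (\<sigma> \<gamma>)) (\<sigma> \<beta>)
             - \<sigma> (rep_D br \<rho> \<mu> (r \<alpha>) (r \<beta>) \<gamma>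
                  + \<mu> (r \<beta>) (r \<gamma>) \<alpha> - \<mu> (r \<alpha>) (r \<gamma>) \<beta>)))"

definition deformation_rel ::
  "('k \<Rightarrow> 'a::ab_group_add \<Rightarrow> 'a) \<Rightarrow> 'a set \<Rightarrow> ('a \<Rightarrow> 'a \<Rightarrow> 'a) \<Rightarrow> ('a \<Rightarrow> 'a \<Rightarrow> 'a \<Rightarrow> 'a)
    \<Rightarrow> ('k \<Rightarrow> 'b::ab_group_add \<Rightarrow> 'b) \<Rightarrow> 'b set \<Rightarrow> ('b \<Rightarrow> 'b \<Rightarrow> 'b) \<Rightarrow> ('b \<Rightarrow> 'b \<Rightarrow> 'b \<Rightarrow> 'b)
    \<Rightarrow> ('a \<Rightarrow> 'b \<Rightarrow> 'b) \<Rightarrow> ('a \<Rightarrow> 'a \<Rightarrow> 'b \<Rightarrow> 'b)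
    \<Rightarrow> ('b \<Rightarrow> 'a \<Rightarrow> 'a) \<Rightarrow> ('b \<Rightarrow> 'b \<Rightarrow> 'a \<Rightarrow> 'a) \<Rightarrow> (('b \<Rightarrow> 'a) \<times> ('b \<Rightarrow> 'a)) set" where
  "deformation_rel sg g br tri sh h br' tri' \<rho> \<mu> \<psi> \<nu> =
     {(r, r'). r \<in> deformation_maps sg g br tri sh h br' tri' \<rho> \<mu> \<psi> \<nu> \<and>
               r' \<in> deformation_maps sg g br tri sh h br' tri' \<rho> \<mu> \<psi> \<nu> \<and>
               deformation_equiv br sh h br' tri' \<rho> \<mu> r r'}"

end

theory Submission
  imports Defs
begin

text \<open>
  A complement of \<open>g\<close> is the same thing as the graph \<open>{r \<alpha> + \<alpha> | \<alpha> \<in> h}\<close> of a linear map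
  \<open>r : h \<rightarrow> g\<close> that happens to be closed under the operations of \<open>E\<close>. Written in \<open>g\<close>- and
  \<open>h\<close>-components, closedness says exactly that \<open>r\<close> is a deformation map. Pulling the structure of
  the graph back along \<open>\<alpha> \<mapsto> r \<alpha> + \<alpha>\<close> gives a twisted structure on \<open>h\<close>, and an
  equivalence \<open>r \<sim> r'\<close> is an isomorphism between the two twisted structures. So the bijection from
  deformation maps to complements carries \<open>\<sim>\<close> to isomorphism.
\<close>

section \<open>Equivalence relations pulled back along a bijection\<close>

text \<open>Since \<open>f\<close> maps \<open>D\<close> onto \<open>C\<close>, each class
  \<open>X\<close> of \<open>R\<close> is the image under \<open>f\<close> of its preimage in
  \<open>D\<close>, so preimages separate classes; the preimage of the class of \<open>f a\<close>
  is the class of \<open>a\<close> for \<open>S\<close>. The theorem thereby reduces to a bijection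
  that turns one relation into the other.\<close>

lemma equiv_pullback_bij:
  assumes R: "equiv C R" and f: "bij_betw f D C"
    and S: "S = {(a, b). a \<in> D \<and> b \<in> D \<and> (f a, f b) \<in> R}"
  shows "equiv D S" and "bij_betw (\<lambda>X. f -` X \<inter> D) (C // R) (D // S)"
proof -
  have fD: "f ` D = C" and inj: "inj_on f D"
    using f by (auto simp: bij_betw_def)
  have sym: "sym R" and trans: "trans R" and RC: "R \<subseteq> C \<times> C"
    and rC: "\<And>x. x \<in> C \<Longrightarrow> (x, x) \<in> R"
    using R by (auto simp: equiv_def refl_on_def)
  show "equiv D S"
    using sym trans rC fD by (auto simp: S equiv_def refl_on_def intro!: symI transI dest: symD transD)
  have cls: "f -` (R `` {f a}) \<inter> D = S `` {a}" if "a \<in> D" for a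
    using that by (auto simp: S)
  show "bij_betw (\<lambda>X. f -` X \<inter> D) (C // R) (D // S)"
    unfolding bij_betw_def
  proof
    have "f ` (f -` X \<inter> D) = X" if "X \<in> C // R" for X
    proof -
      have "X \<subseteq> f ` D" using that RC unfolding fD quotient_def by auto
      then show ?thesis by auto
    qed
    then show "inj_on (\<lambda>X. f -` X \<inter> D) (C // R)"
      by (rule inj_on_inverseI)
    have "(\<lambda>X. f -` X \<inter> D) ` (C // R) = (\<lambda>a. f -` (R `` {f a}) \<inter> D) ` D"
      unfolding quotient_def fD[symmetric] by auto
    also have "\<dots> = (\<lambda>a. S `` {a}) ` D"
      using cls by (intro image_cong) auto
    finally show "(\<lambda>X. f -` X \<inter> D) ` (C // R) = D // S"
      unfolding quotient_def by auto
  qed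
qed

section \<open>Isomorphisms of Lie-Yamaguti algebras\<close>

lemma ly_isomorphism_id: "ly_isomorphism s L b t s L b t (\<lambda>x. x)"
  by (auto simp: ly_isomorphism_def linear_map_on_def bij_betw_def)

lemma ly_isomorphism_comp:
  assumes "ly_isomorphism s1 L1 b1 t1 s2 L2 b2 t2 f" "ly_isomorphism s2 L2 b2 t2 s3 L3 b3 t3 k"
  shows "ly_isomorphism s1 L1 b1 t1 s3 L3 b3 t3 (k \<circ> f)"
  using assms unfolding ly_isomorphism_def linear_map_on_def
  by (auto simp: Pi_iff intro: bij_betw_trans)

text \<open>Every element of \<open>L2\<close> has the form \<open>f x\<close> with \<open>x\<close>
  in \<open>L1\<close>, so each identity for the inverse reduces to the one for \<open>f\<close>.
  Closure is asked of \<open>L1\<close> because \<open>inv_into L1 f\<close> undoes \<open>f\<close>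
  only there.\<close>

lemma ly_isomorphism_inv:
  assumes f: "ly_isomorphism s1 L1 b1 t1 s2 L2 b2 t2 f"
    and add: "\<And>x y. x \<in> L1 \<Longrightarrow> y \<in> L1 \<Longrightarrow> x + y \<in> L1"
    and scale: "\<And>c x. x \<in> L1 \<Longrightarrow> s1 c x \<in> L1"
    and b: "\<And>x y. x \<in> L1 \<Longrightarrow> y \<in> L1 \<Longrightarrow> b1 x y \<in> L1"
    and t: "\<And>x y z. x \<in> L1 \<Longrightarrow> y \<in> L1 \<Longrightarrow> z \<in> L1 \<Longrightarrow> t1 x y z \<in> L1"
  shows "ly_isomorphism s2 L2 b2 t2 s1 L1 b1 t1 (inv_into L1 f)"
proof -
  define k where "k = inv_into L1 f"
  have bij: "bij_betw f L1 L2" using f by (simp add: ly_isomorphism_def)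
  then have bk: "bij_betw k L2 L1" unfolding k_def by (rule bij_betw_inv_into)
  have kf: "k (f x) = x" if "x \<in> L1" for x
    using bij that by (simp add: k_def bij_betw_inv_into_left)
  have L2: "L2 = f ` L1" using bij by (simp add: bij_betw_def)
  have "k (f x + f y) = x + y" "k (b2 (f x) (f y)) = b1 x y" if "x \<in> L1" "y \<in> L1" for x y
    using f that kf[OF add[OF that]] kf[OF b[OF that]]
    by (auto simp: ly_isomorphism_def linear_map_on_def)
  moreover have "k (s2 c (f x)) = s1 c x" if "x \<in> L1" for c x
    using f that kf[OF scale[OF that]] by (auto simp: ly_isomorphism_def linear_map_on_def)
  moreover have "k (t2 (f x) (f y) (f z)) = t1 x y z" if "x \<in> L1" "y \<in> L1" "z \<in> L1" for x y z
    using f that kf[OF t[OF that]] by (auto simp: ly_isomorphism_def)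
  ultimately have "ly_isomorphism s2 L2 b2 t2 s1 L1 b1 t1 k"
    using bk kf by (simp add: ly_isomorphism_def linear_map_on_def Pi_iff L2)
  then show ?thesis by (simp add: k_def)
qed

text \<open>Identity and composition give reflexivity and transitivity. For symmetry, a complement
  is a subalgebra and so has the closure properties used in inverting an isomorphism.\<close>

lemma equiv_ly_complement_iso:
  fixes scale :: "'k::field_char_0 \<Rightarrow> 'a::ab_group_add \<Rightarrow> 'a"
  assumes "vector_space scale"
  shows "equiv {h. ly_complement scale E br tri g h} (ly_complement_iso scale E br tri g)"
proof -
  interpret vector_space scale by fact
  have "(h', h) \<in> ly_complement_iso scale E br tri g"
    if hh': "(h, h') \<in> ly_complement_iso scale E br tri g" for h h'
  proof -
    obtain f where f: "ly_isomorphism scale h br tri scale h' br tri f"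
      using hh' unfolding ly_complement_iso_def by blast
    have "ly_subalgebra scale E br tri h"
      using hh' unfolding ly_complement_iso_def ly_complement_def by blast
    then have "ly_isomorphism scale h' br tri scale h br tri (inv_into h f)"
      by (intro ly_isomorphism_inv[OF f]) (auto simp: ly_subalgebra_def subspace_def)
    then show ?thesis using hh' unfolding ly_complement_iso_def by blast
  qed
  then show ?thesis
    by (auto simp: equiv_def refl_on_def sym_def trans_def ly_complement_iso_def
      intro: ly_isomorphism_id ly_isomorphism_comp)
qed

section \<open>Closure, additivity and skew symmetry on a carrier\<close>

lemma (in lie_yamaguti_algebra) closed_carrier:
  shows add_closed: "x \<in> L \<Longrightarrow> y \<in> L \<Longrightarrow> x + y \<in> L"
    and minus_closed: "x \<in> L \<Longrightarrow> - x \<in> L"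
    and diff_closed: "x \<in> L \<Longrightarrow> y \<in> L \<Longrightarrow> x - y \<in> L"
    and zero_closed: "0 \<in> L"
    and scale_closed: "x \<in> L \<Longrightarrow> scale c x \<in> L"
    and br_closed: "x \<in> L \<Longrightarrow> y \<in> L \<Longrightarrow> br x y \<in> L"
    and tri_closed: "x \<in> L \<Longrightarrow> y \<in> L \<Longrightarrow> z \<in> L \<Longrightarrow> tri x y z \<in> L"
  using carrier_subspace br_linear1 tri_linear1
  by (auto simp: subspace_add subspace_neg subspace_diff subspace_0 subspace_scale linear_map_on_def Pi_iff)

lemma (in lie_yamaguti_algebra) additive_operations:
  shows br_add_left: "x \<in> L \<Longrightarrow> x' \<in> L \<Longrightarrow> y \<in> L \<Longrightarrow> br (x + x') y = br x y + br x' y"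
    and br_add_right: "x \<in> L \<Longrightarrow> y \<in> L \<Longrightarrow> y' \<in> L \<Longrightarrow> br x (y + y') = br x y + br x y'"
    and tri_add1: "x \<in> L \<Longrightarrow> x' \<in> L \<Longrightarrow> y \<in> L \<Longrightarrow> z \<in> L \<Longrightarrow> tri (x + x') y z = tri x y z + tri x' y z"
    and tri_add2: "x \<in> L \<Longrightarrow> y \<in> L \<Longrightarrow> y' \<in> L \<Longrightarrow> z \<in> L \<Longrightarrow> tri x (y + y') z = tri x y z + tri x y' z"
    and tri_add3: "x \<in> L \<Longrightarrow> y \<in> L \<Longrightarrow> z \<in> L \<Longrightarrow> z' \<in> L \<Longrightarrow> tri x y (z + z') = tri x y z + tri x y z'"
  using br_linear1 br_linear2 tri_linear1 tri_linear2 tri_linear3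
  by (simp_all add: linear_map_on_def)

text \<open>Polarisation: expanding \<open>br (x + y) (x + y) = 0\<close> leaves only the two mixed
  terms.\<close>

lemma (in lie_yamaguti_algebra) br_swap:
  assumes "x \<in> L" "y \<in> L"
  shows "br y x = - br x y"
proof -
  have "0 = br (x + y) (x + y)"
    using assms by (simp add: br_alternating add_closed)
  also have "\<dots> = br y x + br x y"
    using assms by (simp add: br_add_left br_add_right br_alternating[of x] br_alternating[of y] closed_carrier)
  finally show ?thesis using eq_neg_iff_add_eq_0 by metis
qed

lemma (in lie_yamaguti_algebra) tri_swap:
  assumes "x \<in> L" "y \<in> L" "z \<in> L"
  shows "tri y x z = - tri x y z"
proof -
  have "0 = tri (x + y) (x + y) z"
    using assms by (simp add: tri_alternating add_closed)
  also have "\<dots> = tri y x z + tri x y z"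
    using assms by (simp add: tri_add1 tri_add2 tri_alternating[of x] tri_alternating[of y] closed_carrier)
  finally show ?thesis using eq_neg_iff_add_eq_0 by metis
qed

lemma (in lie_yamaguti_algebra) br_minus_left:
  assumes "x \<in> L" "y \<in> L"
  shows "br (- x) y = - br x y"
  \<comment> \<open>The instance at \<open>0\<close> and \<open>0\<close> gives
    \<open>br 0 y = 0\<close>, which is the value of \<open>br (- x + x) y\<close>.\<close>
  using br_add_left[of "- x" x y] br_add_left[of 0 0 y] assms
  by (simp add: closed_carrier eq_neg_iff_add_eq_0)

section \<open>Components along \<open>g\<close> and \<open>h\<close>\<close>

text \<open>Pairs \<open>(x, \<alpha>)\<close> of the bicrossed product are represented by sums
  \<open>x + \<alpha>\<close> in \<open>E\<close>, so that \<open>g\<close>, \<open>h\<close> and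
  \<open>E\<close> share one bracket and one triple product.\<close>

locale canonical_pair =
  A: lie_yamaguti_algebra scale E br tri +
  MP: ly_matched_pair scale g br tri scale h br tri \<rho> \<mu> \<psi> \<nu>
  for scale :: "'k::field_char_0 \<Rightarrow> 'e::ab_group_add \<Rightarrow> 'e" and E br tri g h \<rho> \<mu> \<psi> \<nu> +
  assumes complement: "ly_complement scale E br tri g h"
    and br_mixed: "x \<in> g \<Longrightarrow> \<alpha> \<in> h \<Longrightarrow> br x \<alpha> = - \<psi> \<alpha> x + \<rho> x \<alpha>"
    and tri_hgg: "\<alpha> \<in> h \<Longrightarrow> x \<in> g \<Longrightarrow> y \<in> g \<Longrightarrow> tri \<alpha> x y = \<mu> x y \<alpha>"
    and tri_ghh: "x \<in> g \<Longrightarrow> \<alpha> \<in> h \<Longrightarrow> \<beta> \<in> h \<Longrightarrow> tri x \<alpha> \<beta> = \<nu> \<alpha> \<beta> x"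
begin

lemmas g_closed = MP.G.closed_carrier
lemmas h_closed = MP.H.closed_carrier

lemma E_eq: "E = {x + \<alpha> |x \<alpha>. x \<in> g \<and> \<alpha> \<in> h}" and inter: "g \<inter> h = {0}"
  using complement unfolding ly_complement_def by blast+

lemma in_E: "x \<in> g \<Longrightarrow> x \<in> E" "\<alpha> \<in> h \<Longrightarrow> \<alpha> \<in> E"
proof -
  show "\<alpha> \<in> E" if "\<alpha> \<in> h"
    using complement that unfolding ly_complement_def ly_subalgebra_def by blast
  show "x \<in> E" if "x \<in> g"
  proof -
    have "x = x + 0" by simp
    then show ?thesis unfolding E_eq using that h_closed(4) by blast
  qed
qed

lemma action_closed [simp]:
  shows "x \<in> g \<Longrightarrow> \<alpha> \<in> h \<Longrightarrow> \<rho> x \<alpha> \<in> h"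
    and "x \<in> g \<Longrightarrow> y \<in> g \<Longrightarrow> \<alpha> \<in> h \<Longrightarrow> \<mu> x y \<alpha> \<in> h"
    and "\<alpha> \<in> h \<Longrightarrow> x \<in> g \<Longrightarrow> \<psi> \<alpha> x \<in> g"
    and "\<alpha> \<in> h \<Longrightarrow> \<beta> \<in> h \<Longrightarrow> x \<in> g \<Longrightarrow> \<nu> \<alpha> \<beta> x \<in> g"
  using MP.G.rho_End MP.G.mu_End MP.H.rho_End MP.H.mu_End
  by (auto simp: linear_map_on_def Pi_iff)

lemma D_closed [simp]:
  "x \<in> g \<Longrightarrow> y \<in> g \<Longrightarrow> \<alpha> \<in> h \<Longrightarrow> rep_D br \<rho> \<mu> x y \<alpha> \<in> h"
  "\<alpha> \<in> h \<Longrightarrow> \<beta> \<in> h \<Longrightarrow> x \<in> g \<Longrightarrow> rep_D br \<psi> \<nu> \<alpha> \<beta> x \<in> g"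
  unfolding rep_D_def by (simp_all add: g_closed h_closed)

text \<open>The sum is direct: \<open>x - y = \<beta> - \<alpha>\<close> lies in both
  \<open>g\<close> and \<open>h\<close>, which meet only in \<open>0\<close>.\<close>

lemma components_eq:
  assumes "x \<in> g" "\<alpha> \<in> h" "y \<in> g" "\<beta> \<in> h" "x + \<alpha> = y + \<beta>"
  shows "x = y" "\<alpha> = \<beta>"
proof -
  have "x - y = \<beta> - \<alpha>" using assms(5) by (simp add: algebra_simps)
  moreover have "x - y \<in> g" "\<beta> - \<alpha> \<in> h" using assms g_closed h_closed by auto
  ultimately have "x - y \<in> g \<inter> h" by auto
  then have "x - y = 0" unfolding inter by simp
  then show "x = y" "\<alpha> = \<beta>" using assms(5) by auto
qed

text \<open>This mixed value is not prescribed by the canonical equations but forced by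
  \<open>ly1\<close> in \<open>E\<close> at \<open>x\<close>, \<open>y\<close>, \<alpha>. There the
  \<open>g\<close>-terms cancel by \<open>mp10\<close>, and the \<open>h\<close>-terms leave
  \<open>rep_D\<close>.\<close>

lemma tri_ggh:
  assumes x: "x \<in> g" and y: "y \<in> g" and \<alpha>: "\<alpha> \<in> h"
  shows "tri x y \<alpha> = rep_D br \<rho> \<mu> x y \<alpha>"
proof -
  note E = in_E(1)[OF x] in_E(1)[OF y] in_E(2)[OF \<alpha>]
  \<comment> \<open>Both double brackets of \<open>ly1\<close> that pair \<alpha> with one of
    \<open>x\<close>, \<open>y\<close> first are instances of this expansion into components, up to
    sign.\<close>
  have *: "br (br u \<alpha>) w = br w (\<psi> \<alpha> u) + \<psi> (\<rho> u \<alpha>) w - \<rho> w (\<rho> u \<alpha>)"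
    if u: "u \<in> g" and w: "w \<in> g" for u w
  proof -
    have "br (br u \<alpha>) w = br (- \<psi> \<alpha> u) w + br (\<rho> u \<alpha>) w"
      unfolding br_mixed[OF u \<alpha>] using u w \<alpha>
      by (intro A.br_add_left) (simp_all add: in_E g_closed)
    moreover have "br (- \<psi> \<alpha> u) w = br w (\<psi> \<alpha> u)"
      using u w \<alpha> by (simp add: A.br_minus_left in_E A.br_swap[of "\<psi> \<alpha> u" w])
    moreover have "br (\<rho> u \<alpha>) w = - br w (\<rho> u \<alpha>)"
      using u w \<alpha> by (intro A.br_swap in_E) auto
    ultimately show ?thesis using u w \<alpha> by (simp add: br_mixed)
  qed
  have "br \<alpha> x = - br x \<alpha>" using E by (intro A.br_swap)
  then have 1: "br (br \<alpha> x) y = - (br y (\<psi> \<alpha> x) + \<psi> (\<rho> x \<alpha>) y - \<rho> y (\<rho> x \<alpha>))"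
    using E *[OF x y] by (simp add: A.br_minus_left A.br_closed)
  have 2: "br y (\<psi> \<alpha> x) = - br (\<psi> \<alpha> x) y"
    using x y \<alpha> by (intro A.br_swap in_E) auto
  have 3: "tri y \<alpha> x = - \<mu> y x \<alpha>"
    using A.tri_swap[of \<alpha> y x] E x y \<alpha> by (simp add: tri_hgg)
  have 4: "br (br x y) \<alpha> = - \<psi> \<alpha> (br x y) + \<rho> (br x y) \<alpha>"
    using x y \<alpha> by (simp add: br_mixed g_closed)
  have "br (br x y) \<alpha> + br (br y \<alpha>) x + br (br \<alpha> x) y + tri x y \<alpha> + tri y \<alpha> x + tri \<alpha> x y = 0"
    using E by (rule A.ly1)
  then show ?thesis
    unfolding 1 2 3 4 *[OF y x] tri_hgg[OF \<alpha> x y] MP.mp10[OF \<alpha> x y] rep_D_def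
    by (simp add: algebra_simps eq_neg_iff_add_eq_0)
qed

text \<open>The argument of \<open>tri_ggh\<close> with \<open>g\<close> and \<open>h\<close>
  exchanged: in \<open>ly1\<close> at \<alpha>, \<beta>, \<open>x\<close> the \<open>h\<close>-terms
  cancel by \<open>mp1\<close>, and the \<open>g\<close>-terms leave \<open>rep_D\<close>.\<close>

lemma tri_hhg:
  assumes \<alpha>: "\<alpha> \<in> h" and \<beta>: "\<beta> \<in> h" and x: "x \<in> g"
  shows "tri \<alpha> \<beta> x = rep_D br \<psi> \<nu> \<alpha> \<beta> x"
proof -
  note E = in_E(2)[OF \<alpha>] in_E(2)[OF \<beta>] in_E(1)[OF x]
  have *: "br (br x \<gamma>) \<delta> = \<psi> \<delta> (\<psi> \<gamma> x) - \<rho> (\<psi> \<gamma> x) \<delta> + br (\<rho> x \<gamma>) \<delta>"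
    if \<gamma>: "\<gamma> \<in> h" and \<delta>: "\<delta> \<in> h" for \<gamma> \<delta>
  proof -
    have "br (br x \<gamma>) \<delta> = br (- \<psi> \<gamma> x) \<delta> + br (\<rho> x \<gamma>) \<delta>"
      unfolding br_mixed[OF x \<gamma>] using x \<gamma> \<delta>
      by (intro A.br_add_left) (simp_all add: in_E g_closed)
    moreover have "br (- \<psi> \<gamma> x) \<delta> = - br (\<psi> \<gamma> x) \<delta>"
      using x \<gamma> \<delta> by (simp add: A.br_minus_left in_E)
    ultimately show ?thesis using x \<gamma> \<delta> by (simp add: br_mixed)
  qed
  have "br \<beta> x = - br x \<beta>" using E by (intro A.br_swap)
  then have 1: "br (br \<beta> x) \<alpha> = - (\<psi> \<alpha> (\<psi> \<beta> x) - \<rho> (\<psi> \<beta> x) \<alpha> + br (\<rho> x \<beta>) \<alpha>)"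
    using E *[OF \<beta> \<alpha>] by (simp add: A.br_minus_left A.br_closed)
  have 2: "br (\<rho> x \<beta>) \<alpha> = - br \<alpha> (\<rho> x \<beta>)"
    using x \<alpha> \<beta> by (intro A.br_swap in_E) auto
  have 3: "tri \<beta> x \<alpha> = - \<nu> \<beta> \<alpha> x"
    using A.tri_swap[of x \<beta> \<alpha>] E x \<alpha> \<beta> by (simp add: tri_ghh)
  have "br (br \<alpha> \<beta>) x = - br x (br \<alpha> \<beta>)"
    using E by (intro A.br_swap A.br_closed)
  then have 4: "br (br \<alpha> \<beta>) x = \<psi> (br \<alpha> \<beta>) x - \<rho> x (br \<alpha> \<beta>)"
    using x \<alpha> \<beta> by (simp add: br_mixed h_closed)
  have "br (br \<alpha> \<beta>) x + br (br \<beta> x) \<alpha> + br (br x \<alpha>) \<beta> + tri \<alpha> \<beta> x + tri \<beta> x \<alpha> + tri x \<alpha> \<beta> = 0"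
    using E by (rule A.ly1)
  then show ?thesis
    unfolding 1 2 3 4 *[OF \<alpha> \<beta>] tri_ghh[OF x \<alpha> \<beta>] MP.mp1[OF x \<alpha> \<beta>] rep_D_def
    by (simp add: algebra_simps eq_neg_iff_add_eq_0)
qed

section \<open>Twisted structures on \<open>h\<close> and graphs in \<open>E\<close>\<close>

text \<open>The \<open>h\<close>-component of
  \<open>br (r \<alpha> + \<alpha>) (r \<beta> + \<beta>)\<close>, and the argument of
  \<open>r\<close> in the first deformation equation. \<open>twisted_tri\<close> plays the same part
  for \<open>tri\<close> and the second equation.\<close>

definition twisted_br :: "('e \<Rightarrow> 'e) \<Rightarrow> 'e \<Rightarrow> 'e \<Rightarrow> 'e" where
  "twisted_br r \<alpha> \<beta> = br \<alpha> \<beta> + \<rho> (r \<alpha>) \<beta> - \<rho> (r \<beta>) \<alpha>"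

definition twisted_tri :: "('e \<Rightarrow> 'e) \<Rightarrow> 'e \<Rightarrow> 'e \<Rightarrow> 'e \<Rightarrow> 'e" where
  "twisted_tri r \<alpha> \<beta> \<gamma> = tri \<alpha> \<beta> \<gamma> + rep_D br \<rho> \<mu> (r \<alpha>) (r \<beta>) \<gamma>
     + \<mu> (r \<beta>) (r \<gamma>) \<alpha> - \<mu> (r \<alpha>) (r \<gamma>) \<beta>"

definition graph :: "('e \<Rightarrow> 'e) \<Rightarrow> 'e set" where
  "graph r = (\<lambda>\<alpha>. r \<alpha> + \<alpha>) ` h"

abbreviation "DM \<equiv> deformation_maps scale g br tri scale h br tri \<rho> \<mu> \<psi> \<nu>"

text \<open>The bracket of the bicrossed product, grouped as \<open>g\<close>-component plus
  \<open>h\<close>-component.\<close>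

lemma br_sum:
  assumes "x \<in> g" "y \<in> g" "\<alpha> \<in> h" "\<beta> \<in> h"
  shows "br (x + \<alpha>) (y + \<beta>)
    = (br x y + \<psi> \<alpha> y - \<psi> \<beta> x) + (br \<alpha> \<beta> + \<rho> x \<beta> - \<rho> y \<alpha>)"
proof -
  have "br \<alpha> y = \<psi> \<alpha> y - \<rho> y \<alpha>"
    using assms A.br_swap[of y \<alpha>] by (simp add: br_mixed in_E)
  moreover have "br (x + \<alpha>) (y + \<beta>) = br x y + br x \<beta> + (br \<alpha> y + br \<alpha> \<beta>)"
    using assms by (simp add: A.br_add_left A.br_add_right A.add_closed in_E)
  ultimately have "br (x + \<alpha>) (y + \<beta>)
      = br x y + (- \<psi> \<beta> x + \<rho> x \<beta>) + (\<psi> \<alpha> y - \<rho> y \<alpha> + br \<alpha> \<beta>)"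
    using assms by (simp only: br_mixed)
  then show ?thesis by simp
qed

lemma tri_sum:
  assumes "x \<in> g" "y \<in> g" "z \<in> g" "\<alpha> \<in> h" "\<beta> \<in> h" "\<gamma> \<in> h"
  shows "tri (x + \<alpha>) (y + \<beta>) (z + \<gamma>)
    = (tri x y z + rep_D br \<psi> \<nu> \<alpha> \<beta> z + \<nu> \<beta> \<gamma> x - \<nu> \<alpha> \<gamma> y)
      + (tri \<alpha> \<beta> \<gamma> + rep_D br \<rho> \<mu> x y \<gamma> + \<mu> y z \<alpha> - \<mu> x z \<beta>)"
proof -
  \<comment> \<open>Of the eight terms of the trilinear expansion, these two have to be
    skew-symmetrised before \<open>tri_hgg\<close> and \<open>tri_ghh\<close> apply.\<close>
  have "tri x \<beta> z = - \<mu> x z \<beta>" "tri \<alpha> y \<gamma> = - \<nu> \<alpha> \<gamma> y"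
    using assms A.tri_swap[of \<beta> x z] A.tri_swap[of y \<alpha> \<gamma>] by (simp_all add: tri_hgg tri_ghh in_E)
  moreover have "tri (x + \<alpha>) (y + \<beta>) (z + \<gamma>)
      = tri x y z + tri x y \<gamma> + (tri x \<beta> z + tri x \<beta> \<gamma>)
        + (tri \<alpha> y z + tri \<alpha> y \<gamma> + (tri \<alpha> \<beta> z + tri \<alpha> \<beta> \<gamma>))"
    using assms by (simp add: A.tri_add1 A.tri_add2 A.tri_add3 A.add_closed in_E)
  ultimately show ?thesis
    using assms by (simp add: tri_hgg tri_ghh tri_ggh tri_hhg algebra_simps)
qed

lemma twisted_closed:
  assumes "r \<in> h \<rightarrow> g"
  shows "\<alpha> \<in> h \<Longrightarrow> \<beta> \<in> h \<Longrightarrow> twisted_br r \<alpha> \<beta> \<in> h"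
    and "\<alpha> \<in> h \<Longrightarrow> \<beta> \<in> h \<Longrightarrow> \<gamma> \<in> h \<Longrightarrow> twisted_tri r \<alpha> \<beta> \<gamma> \<in> h"
  using assms by (simp_all add: twisted_br_def twisted_tri_def h_closed Pi_iff)

text \<open>By directness of the sum, the only graph point with \<open>h\<close>-component \<alpha>
  is \<open>r \<alpha> + \<alpha>\<close>. This turns membership in the graph into an equation in
  \<open>g\<close>.\<close>

lemma sum_in_graph_iff:
  assumes r: "r \<in> h \<rightarrow> g" and "x \<in> g" "\<alpha> \<in> h"
  shows "x + \<alpha> \<in> graph r \<longleftrightarrow> x = r \<alpha>"
proof
  assume "x + \<alpha> \<in> graph r"
  then obtain \<beta> where \<beta>: "\<beta> \<in> h" "x + \<alpha> = r \<beta> + \<beta>" by (auto simp: graph_def)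
  moreover have "r \<beta> \<in> g" using r \<beta> by auto
  ultimately have "x = r \<beta>" "\<alpha> = \<beta>" using components_eq[of x \<alpha> "r \<beta>" \<beta>] assms by blast+
  then show "x = r \<alpha>" by simp
qed (use assms in \<open>auto simp: graph_def\<close>)

text \<open>The \<open>h\<close>-component of the bracket is
  \<open>twisted_br r \<alpha> \<beta>\<close>, so membership says that the
  \<open>g\<close>-component is its image under \<open>r\<close>: the first deformation
  equation.\<close>

lemma br_in_graph_iff:
  assumes r: "r \<in> h \<rightarrow> g" and "\<alpha> \<in> h" "\<beta> \<in> h"
  shows "br (r \<alpha> + \<alpha>) (r \<beta> + \<beta>) \<in> graph r \<longleftrightarrow>
    br (r \<alpha>) (r \<beta>) + \<psi> \<alpha> (r \<beta>) - \<psi> \<beta> (r \<alpha>) = r (twisted_br r \<alpha> \<beta>)"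
proof -
  have rg: "r \<alpha> \<in> g" "r \<beta> \<in> g" using assms by auto
  then have "br (r \<alpha>) (r \<beta>) + \<psi> \<alpha> (r \<beta>) - \<psi> \<beta> (r \<alpha>) \<in> g"
    using assms by (simp add: g_closed)
  then show ?thesis
    using sum_in_graph_iff[OF r _ twisted_closed(1)[OF assms]] rg assms
    by (simp add: br_sum twisted_br_def)
qed

lemma tri_in_graph_iff:
  assumes r: "r \<in> h \<rightarrow> g" and "\<alpha> \<in> h" "\<beta> \<in> h" "\<gamma> \<in> h"
  shows "tri (r \<alpha> + \<alpha>) (r \<beta> + \<beta>) (r \<gamma> + \<gamma>) \<in> graph r \<longleftrightarrow>
    tri (r \<alpha>) (r \<beta>) (r \<gamma>) + rep_D br \<psi> \<nu> \<alpha> \<beta> (r \<gamma>) + \<nu> \<beta> \<gamma> (r \<alpha>) - \<nu> \<alpha> \<gamma> (r \<beta>)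
      = r (twisted_tri r \<alpha> \<beta> \<gamma>)"
proof -
  have rg: "r \<alpha> \<in> g" "r \<beta> \<in> g" "r \<gamma> \<in> g" using assms by auto
  then have "tri (r \<alpha>) (r \<beta>) (r \<gamma>) + rep_D br \<psi> \<nu> \<alpha> \<beta> (r \<gamma>) + \<nu> \<beta> \<gamma> (r \<alpha>) - \<nu> \<alpha> \<gamma> (r \<beta>) \<in> g"
    using assms by (simp add: g_closed)
  then show ?thesis
    using sum_in_graph_iff[OF r _ twisted_closed(2)[OF assms]] rg assms
    by (simp add: tri_sum twisted_tri_def)
qed

section \<open>Deformation maps and complements\<close>

lemma mem_DM_iff:
  "r \<in> DM \<longleftrightarrow> r \<in> extensional h \<and> linear_map_on scale h scale g r \<and>
     (\<forall>X\<in>graph r. \<forall>Y\<in>graph r. br X Y \<in> graph r) \<and>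
     (\<forall>X\<in>graph r. \<forall>Y\<in>graph r. \<forall>Z\<in>graph r. tri X Y Z \<in> graph r)"
\<comment> \<open>Linearity supplies \<open>r \<in> h \<rightarrow> g\<close>, on which the
  membership criteria rest; for a nonlinear \<open>r\<close> both sides are false.\<close>
proof (cases "linear_map_on scale h scale g r")
  case True
  then have r: "r \<in> h \<rightarrow> g" by (simp add: linear_map_on_def)
  have "(\<forall>X\<in>graph r. \<forall>Y\<in>graph r. br X Y \<in> graph r) \<longleftrightarrow>
      (\<forall>\<alpha>\<in>h. \<forall>\<beta>\<in>h. br (r \<alpha> + \<alpha>) (r \<beta> + \<beta>) \<in> graph r)"
    "(\<forall>X\<in>graph r. \<forall>Y\<in>graph r. \<forall>Z\<in>graph r. tri X Y Z \<in> graph r) \<longleftrightarrow>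
      (\<forall>\<alpha>\<in>h. \<forall>\<beta>\<in>h. \<forall>\<gamma>\<in>h. tri (r \<alpha> + \<alpha>) (r \<beta> + \<beta>) (r \<gamma> + \<gamma>) \<in> graph r)"
    unfolding graph_def by simp_all
  then show ?thesis
    using br_in_graph_iff[OF r] tri_in_graph_iff[OF r]
    by (simp add: deformation_maps_def twisted_br_def twisted_tri_def)
qed (simp add: deformation_maps_def)

lemma DM_linear: "r \<in> DM \<Longrightarrow> linear_map_on scale h scale g r"
  by (simp add: mem_DM_iff)

lemma DM_maps: "r \<in> DM \<Longrightarrow> r \<in> h \<rightarrow> g"
  using DM_linear by (simp add: linear_map_on_def)

text \<open>The twisted operations are the \<open>h\<close>-components of the operations on the
  graph, and the deformation equations say that the \<open>g\<close>-components are their images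
  under \<open>r\<close>. Injectivity comes from directness of the sum.\<close>

lemma graph_isomorphism:
  assumes "r \<in> DM"
  shows "ly_isomorphism scale h (twisted_br r) (twisted_tri r) scale (graph r) br tri (\<lambda>\<alpha>. r \<alpha> + \<alpha>)"
proof -
  note lin = DM_linear[OF assms] and r = DM_maps[OF assms]
  have rg: "r \<alpha> \<in> g" if "\<alpha> \<in> h" for \<alpha> using r that by auto
  have "linear_map_on scale h scale (graph r) (\<lambda>\<alpha>. r \<alpha> + \<alpha>)"
    using lin by (auto simp: linear_map_on_def graph_def A.scale_right_distrib)
  moreover have "inj_on (\<lambda>\<alpha>. r \<alpha> + \<alpha>) h"
    using components_eq(2) rg by (intro inj_onI) blast
  moreover have "r (twisted_br r \<alpha> \<beta>) + twisted_br r \<alpha> \<beta> = br (r \<alpha> + \<alpha>) (r \<beta> + \<beta>)"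
    if "\<alpha> \<in> h" "\<beta> \<in> h" for \<alpha> \<beta>
    using assms that rg unfolding deformation_maps_def
    by (simp add: br_sum twisted_br_def)
  moreover have "r (twisted_tri r \<alpha> \<beta> \<gamma>) + twisted_tri r \<alpha> \<beta> \<gamma>
      = tri (r \<alpha> + \<alpha>) (r \<beta> + \<beta>) (r \<gamma> + \<gamma>)"
    if "\<alpha> \<in> h" "\<beta> \<in> h" "\<gamma> \<in> h" for \<alpha> \<beta> \<gamma>
    using assms that rg unfolding deformation_maps_def
    by (simp add: tri_sum twisted_tri_def)
  ultimately show ?thesis
    unfolding ly_isomorphism_def by (simp add: bij_betw_def graph_def)
qed

text \<open>Linearity of \<open>r\<close> makes the graph a subspace and \<open>mem_DM_iff\<close>
  makes it a subalgebra. It replaces \<open>h\<close> as a complement because \<open>r\<close> only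
  shifts elements of \<open>h\<close> by elements of \<open>g\<close>.\<close>

lemma graph_complement:
  assumes "r \<in> DM"
  shows "ly_complement scale E br tri g (graph r)"
proof -
  note lin = DM_linear[OF assms] and r = DM_maps[OF assms]
  have rg: "r \<alpha> \<in> g" if "\<alpha> \<in> h" for \<alpha> using r that by auto
  have "r (0 + 0) = r 0 + r 0"
    using lin h_closed(4) unfolding linear_map_on_def by blast
  then have r0: "r 0 = 0" by simp
  have "A.subspace (graph r)"
  proof (rule A.subspaceI)
    show "0 \<in> graph r" using r0 h_closed(4) unfolding graph_def by force
    show "X + Y \<in> graph r" if X: "X \<in> graph r" "Y \<in> graph r" for X Y
    proof -
      obtain \<alpha> \<beta> where *: "\<alpha> \<in> h" "\<beta> \<in> h" "X = r \<alpha> + \<alpha>" "Y = r \<beta> + \<beta>"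
        using X unfolding graph_def by blast
      then have "X + Y = r (\<alpha> + \<beta>) + (\<alpha> + \<beta>)"
        using lin by (simp add: linear_map_on_def)
      then show ?thesis
        unfolding graph_def by (rule image_eqI) (simp add: * h_closed)
    qed
    show "scale c X \<in> graph r" if X: "X \<in> graph r" for c X
    proof -
      obtain \<alpha> where *: "\<alpha> \<in> h" "X = r \<alpha> + \<alpha>"
        using X unfolding graph_def by blast
      then have "scale c X = r (scale c \<alpha>) + scale c \<alpha>"
        using lin by (simp add: linear_map_on_def A.scale_right_distrib)
      then show ?thesis
        unfolding graph_def by (rule image_eqI) (simp add: * h_closed)
    qed
  qed
  moreover have sub: "graph r \<subseteq> E"
    using rg by (auto simp: graph_def E_eq)
  ultimately have "ly_subalgebra scale E br tri (graph r)"
    using assms by (simp add: ly_subalgebra_def mem_DM_iff)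
  moreover have "E = {x + X |x X. x \<in> g \<and> X \<in> graph r}" (is "_ = ?S")
  proof
    show "?S \<subseteq> E" using sub in_E A.add_closed by blast
    show "E \<subseteq> ?S"
    proof
      fix X assume "X \<in> E"
      then obtain x \<alpha> where *: "X = x + \<alpha>" "x \<in> g" "\<alpha> \<in> h" by (auto simp: E_eq)
      then have "X = (x - r \<alpha>) + (r \<alpha> + \<alpha>)" "x - r \<alpha> \<in> g" "r \<alpha> + \<alpha> \<in> graph r"
        using rg g_closed(3) by (auto simp: graph_def)
      then show "X \<in> ?S" by blast
    qed
  qed
  moreover have "g \<inter> graph r = {0}"
  proof -
    \<comment> \<open>Here \<open>X\<close> is read as \<open>X + 0\<close>, with
      \<open>h\<close>-component \<open>0\<close>, so lying on the graph forces
      \<open>X = r 0\<close>.\<close>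
    have "X = 0" if "X \<in> g" "X \<in> graph r" for X
      using that sum_in_graph_iff[OF r, of X 0] r0 h_closed(4) by simp
    moreover have "0 \<in> graph r" using r0 h_closed(4) unfolding graph_def by force
    ultimately show ?thesis using g_closed(4) by blast
  qed
  ultimately show ?thesis unfolding ly_complement_def by blast
qed

text \<open>The map is \<alpha> to minus its \<open>g\<close>-component in the decomposition of
  \<open>E\<close> along \<open>g\<close> and \<open>k\<close>: this is the shift that moves
  \<alpha> into \<open>k\<close>.\<close>

lemma complement_is_graph:
  assumes C: "ly_complement scale E br tri g k"
  shows "\<exists>r\<in>DM. graph r = k"
proof -
  have alg: "ly_subalgebra scale E br tri k"
    and Ek: "E = {x + X |x X. x \<in> g \<and> X \<in> k}" and int: "g \<inter> k = {0}"
    using C unfolding ly_complement_def by blast+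
  have kE: "k \<subseteq> E" and sub: "A.subspace k"
    and kb: "\<forall>X\<in>k. \<forall>Y\<in>k. br X Y \<in> k" and kt: "\<forall>X\<in>k. \<forall>Y\<in>k. \<forall>Z\<in>k. tri X Y Z \<in> k"
    using alg by (simp_all add: ly_subalgebra_def)
  have "\<exists>x. x \<in> g \<and> x + \<alpha> \<in> k" if \<alpha>: "\<alpha> \<in> h" for \<alpha>
  proof -
    obtain x X where *: "\<alpha> = x + X" "x \<in> g" "X \<in> k" using in_E(2)[OF \<alpha>] Ek by blast
    then have "- x \<in> g" "- x + \<alpha> \<in> k" using g_closed(2) by auto
    then show ?thesis by blast
  qed
  then obtain r0 where r0: "r0 \<alpha> \<in> g" "r0 \<alpha> + \<alpha> \<in> k" if "\<alpha> \<in> h" for \<alpha> by metis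
  \<comment> \<open>Restriction makes the chosen function extensional, as membership in
    \<open>DM\<close> demands.\<close>
  define r where "r = restrict r0 h"
  have rg: "r \<alpha> \<in> g" and rk: "r \<alpha> + \<alpha> \<in> k" if "\<alpha> \<in> h" for \<alpha>
    using r0 that by (auto simp: r_def)
  \<comment> \<open>Two shifts of the same \<alpha> into \<open>k\<close> differ by an element of
    \<open>g\<close> and \<open>k\<close>, hence by \<open>0\<close>. Linearity of \<open>r\<close>
    and the inclusion of \<open>k\<close> in its graph both follow from this uniqueness.\<close>
  have uniq: "x = r \<alpha>" if "\<alpha> \<in> h" "x \<in> g" "x + \<alpha> \<in> k" for x \<alpha>
  proof -
    have "(x + \<alpha>) - (r \<alpha> + \<alpha>) \<in> k" using that by (intro A.subspace_diff[OF sub] rk)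
    moreover have "x - r \<alpha> \<in> g" using that rg g_closed(3) by auto
    ultimately have "x - r \<alpha> \<in> g \<inter> k" by simp
    then have "x - r \<alpha> = 0" unfolding int by simp
    then show ?thesis by simp
  qed
  have "r (\<alpha> + \<beta>) = r \<alpha> + r \<beta>" if "\<alpha> \<in> h" "\<beta> \<in> h" for \<alpha> \<beta>
  proof -
    have "(r \<alpha> + \<alpha>) + (r \<beta> + \<beta>) \<in> k" using that by (intro A.subspace_add[OF sub] rk)
    moreover have "(r \<alpha> + \<alpha>) + (r \<beta> + \<beta>) = (r \<alpha> + r \<beta>) + (\<alpha> + \<beta>)" by (simp add: algebra_simps)
    ultimately show ?thesis
      using uniq[of "\<alpha> + \<beta>" "r \<alpha> + r \<beta>"] that rg g_closed(1) h_closed(1) by simp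
  qed
  moreover have "r (scale c \<alpha>) = scale c (r \<alpha>)" if "\<alpha> \<in> h" for c \<alpha>
  proof -
    have "scale c (r \<alpha> + \<alpha>) \<in> k" using that by (intro A.subspace_scale[OF sub] rk)
    then show ?thesis
      using uniq[of "scale c \<alpha>" "scale c (r \<alpha>)"] that rg g_closed(5) h_closed(5)
      by (simp add: A.scale_right_distrib)
  qed
  ultimately have "linear_map_on scale h scale g r"
    using rg by (auto simp: linear_map_on_def)
  moreover have "r \<in> extensional h" by (simp add: r_def)
  moreover have graph: "graph r = k"
  proof
    show "graph r \<subseteq> k" using rk by (auto simp: graph_def)
    show "k \<subseteq> graph r"
    proof
      fix X assume X: "X \<in> k"
      then obtain x \<alpha> where *: "X = x + \<alpha>" "x \<in> g" "\<alpha> \<in> h" using kE E_eq by blast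
      then show "X \<in> graph r" using X uniq by (auto simp: graph_def)
    qed
  qed
  ultimately have "r \<in> DM" using kb kt by (simp add: mem_DM_iff)
  then show ?thesis using graph by blast
qed

lemma bij_graph: "bij_betw graph DM {k. ly_complement scale E br tri g k}"
  unfolding bij_betw_def
proof
  show "graph ` DM = {k. ly_complement scale E br tri g k}"
    using graph_complement complement_is_graph by blast
  show "inj_on graph DM"
  proof (rule inj_onI)
    fix r r' assume *: "r \<in> DM" "r' \<in> DM" "graph r = graph r'"
    have "r \<alpha> = r' \<alpha>" if "\<alpha> \<in> h" for \<alpha>
    proof -
      have "r \<alpha> + \<alpha> \<in> graph r'" using * that by (auto simp: graph_def)
      then show ?thesis using sum_in_graph_iff[of r' "r \<alpha>" \<alpha>] DM_maps * that by blast
    qed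
    \<comment> \<open>Agreement on \<open>h\<close> suffices, since both functions are
      extensional.\<close>
    then show "r = r'"
      using * by (intro extensionalityI[of _ h]) (auto simp: mem_DM_iff)
  qed
qed

section \<open>Equivalence of deformation maps as isomorphism of graphs\<close>

text \<open>For a linear \<sigma>, moving the correction terms across each equation of the
  equivalence gives preservation of a twisted operation.\<close>

lemma deformation_equiv_iff_twisted:
  assumes r: "r \<in> h \<rightarrow> g" and r': "r' \<in> h \<rightarrow> g"
  shows "deformation_equiv br scale h br tri \<rho> \<mu> r r' \<longleftrightarrow>
    (\<exists>\<sigma>. ly_isomorphism scale h (twisted_br r) (twisted_tri r)
           scale h (twisted_br r') (twisted_tri r') \<sigma>)"
proof -
  have rg: "r \<alpha> \<in> g" if "\<alpha> \<in> h" for \<alpha> using r that by auto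
  have br_iff: "(\<sigma> (br \<alpha> \<beta>) - br (\<sigma> \<alpha>) (\<sigma> \<beta>)
      = \<rho> (r' (\<sigma> \<alpha>)) (\<sigma> \<beta>) - \<rho> (r' (\<sigma> \<beta>)) (\<sigma> \<alpha>) - \<sigma> (\<rho> (r \<alpha>) \<beta> - \<rho> (r \<beta>) \<alpha>)) \<longleftrightarrow>
      \<sigma> (twisted_br r \<alpha> \<beta>) = twisted_br r' (\<sigma> \<alpha>) (\<sigma> \<beta>)"
    if \<sigma>: "linear_map_on scale h scale h \<sigma>" and "\<alpha> \<in> h" "\<beta> \<in> h" for \<sigma> \<alpha> \<beta>
  proof -
    \<comment> \<open>\<sigma> is additive only on \<open>h\<close>, so both summands have to lie
      there.\<close>
    have "\<rho> (r \<alpha>) \<beta> - \<rho> (r \<beta>) \<alpha> \<in> h" "br \<alpha> \<beta> \<in> h"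
      using that rg by (simp_all add: h_closed)
    then have "\<sigma> (br \<alpha> \<beta> + (\<rho> (r \<alpha>) \<beta> - \<rho> (r \<beta>) \<alpha>)) = \<sigma> (br \<alpha> \<beta>) + \<sigma> (\<rho> (r \<alpha>) \<beta> - \<rho> (r \<beta>) \<alpha>)"
      using \<sigma> by (simp add: linear_map_on_def)
    then have "\<sigma> (twisted_br r \<alpha> \<beta>) = \<sigma> (br \<alpha> \<beta>) + \<sigma> (\<rho> (r \<alpha>) \<beta> - \<rho> (r \<beta>) \<alpha>)"
      by (simp add: twisted_br_def algebra_simps)
    then show ?thesis by (auto simp: twisted_br_def algebra_simps)
  qed
  have tri_iff: "(\<sigma> (tri \<alpha> \<beta> \<gamma>) - tri (\<sigma> \<alpha>) (\<sigma> \<beta>) (\<sigma> \<gamma>)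
      = rep_D br \<rho> \<mu> (r' (\<sigma> \<alpha>)) (r' (\<sigma> \<beta>)) (\<sigma> \<gamma>)
        + \<mu> (r' (\<sigma> \<beta>)) (r' (\<sigma> \<gamma>)) (\<sigma> \<alpha>) - \<mu> (r' (\<sigma> \<alpha>)) (r' (\<sigma> \<gamma>)) (\<sigma> \<beta>)
        - \<sigma> (rep_D br \<rho> \<mu> (r \<alpha>) (r \<beta>) \<gamma> + \<mu> (r \<beta>) (r \<gamma>) \<alpha> - \<mu> (r \<alpha>) (r \<gamma>) \<beta>)) \<longleftrightarrow>
      \<sigma> (twisted_tri r \<alpha> \<beta> \<gamma>) = twisted_tri r' (\<sigma> \<alpha>) (\<sigma> \<beta>) (\<sigma> \<gamma>)"
    if \<sigma>: "linear_map_on scale h scale h \<sigma>" and "\<alpha> \<in> h" "\<beta> \<in> h" "\<gamma> \<in> h" for \<sigma> \<alpha> \<beta> \<gamma>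
  proof -
    define d where "d = rep_D br \<rho> \<mu> (r \<alpha>) (r \<beta>) \<gamma> + \<mu> (r \<beta>) (r \<gamma>) \<alpha> - \<mu> (r \<alpha>) (r \<gamma>) \<beta>"
    have "d \<in> h" "tri \<alpha> \<beta> \<gamma> \<in> h"
      using that rg by (simp_all add: d_def h_closed)
    then have "\<sigma> (tri \<alpha> \<beta> \<gamma> + d) = \<sigma> (tri \<alpha> \<beta> \<gamma>) + \<sigma> d"
      using \<sigma> by (simp add: linear_map_on_def)
    moreover have "twisted_tri r \<alpha> \<beta> \<gamma> = tri \<alpha> \<beta> \<gamma> + d"
      by (simp add: twisted_tri_def d_def algebra_simps)
    ultimately show ?thesis
      unfolding d_def[symmetric] by (auto simp: twisted_tri_def algebra_simps)
  qed
  show ?thesis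
    unfolding deformation_equiv_def ly_isomorphism_def
    \<comment> \<open>The same \<sigma> serves both sides. Its linearity and bijectivity are matched
      first and remain available as assumptions for \<open>br_iff\<close> and
      \<open>tri_iff\<close>.\<close>
    by (rule iff_exI, rule conj_cong[OF refl], rule conj_cong[OF refl], rule conj_cong)
      (intro ball_cong refl br_iff tri_iff; assumption)+
qed

text \<open>Isomorphisms between twisted structures and isomorphisms between graphs correspond by
  conjugation with the maps from \<open>graph_isomorphism\<close>.\<close>

lemma deformation_equiv_iff_graph_iso:
  assumes r: "r \<in> DM" and r': "r' \<in> DM"
  shows "deformation_equiv br scale h br tri \<rho> \<mu> r r' \<longleftrightarrow>
    (\<exists>f. ly_isomorphism scale (graph r) br tri scale (graph r') br tri f)"
proof -
  let ?u = "\<lambda>r \<alpha>. r \<alpha> + \<alpha>"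
  have inv: "ly_isomorphism scale (graph s) br tri scale h (twisted_br s) (twisted_tri s) (inv_into h (?u s))"
    if "s \<in> DM" for s
    by (rule ly_isomorphism_inv[OF graph_isomorphism[OF that]])
      (simp_all add: h_closed twisted_closed[OF DM_maps[OF that]])
  show ?thesis
    unfolding deformation_equiv_iff_twisted[OF DM_maps[OF r] DM_maps[OF r']]
  proof
    assume "\<exists>\<sigma>. ly_isomorphism scale h (twisted_br r) (twisted_tri r)
      scale h (twisted_br r') (twisted_tri r') \<sigma>"
    then obtain \<sigma> where \<sigma>: "ly_isomorphism scale h (twisted_br r) (twisted_tri r)
      scale h (twisted_br r') (twisted_tri r') \<sigma>" ..
    show "\<exists>f. ly_isomorphism scale (graph r) br tri scale (graph r') br tri f"
      by (rule exI, rule ly_isomorphism_comp[OF inv[OF r]],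
          rule ly_isomorphism_comp[OF \<sigma> graph_isomorphism[OF r']])
  next
    assume "\<exists>f. ly_isomorphism scale (graph r) br tri scale (graph r') br tri f"
    then obtain f where f: "ly_isomorphism scale (graph r) br tri scale (graph r') br tri f" ..
    show "\<exists>\<sigma>. ly_isomorphism scale h (twisted_br r) (twisted_tri r)
      scale h (twisted_br r') (twisted_tri r') \<sigma>"
      by (rule exI, rule ly_isomorphism_comp[OF graph_isomorphism[OF r]],
          rule ly_isomorphism_comp[OF f inv[OF r']])
  qed
qed

text \<open>The shape in which \<open>equiv_pullback_bij\<close> takes the relation, with
  \<open>graph\<close> as the bijection.\<close>

lemma deformation_rel_pullback:
  "deformation_rel scale g br tri scale h br tri \<rho> \<mu> \<psi> \<nu>
    = {(r, r'). r \<in> DM \<and> r' \<in> DM \<and> (graph r, graph r') \<in> ly_complement_iso scale E br tri g}"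
  using deformation_equiv_iff_graph_iso graph_complement
  by (auto simp: deformation_rel_def ly_complement_iso_def)

end

section \<open>Classification of complements by deformation maps\<close>

theorem theorem4p11:
  fixes scale :: "'k::field_char_0 \<Rightarrow> 'e::ab_group_add \<Rightarrow> 'e"
    and E g h :: "'e set"
    and br \<rho> \<psi> :: "'e \<Rightarrow> 'e \<Rightarrow> 'e"
    and tri \<mu> \<nu> :: "'e \<Rightarrow> 'e \<Rightarrow> 'e \<Rightarrow> 'e"
  defines "DM \<equiv> deformation_maps scale g br tri scale h br tri \<rho> \<mu> \<psi> \<nu>"
    and "DM_rel \<equiv> deformation_rel scale g br tri scale h br tri \<rho> \<mu> \<psi> \<nu>"
  assumes "lie_yamaguti_algebra scale E br tri"
    and "ly_subalgebra scale E br tri g"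
    and "ly_strong_complement scale E br tri g h"
    and "canonical_matched_pair scale br tri g h \<rho> \<mu> \<psi> \<nu>"
  shows "equiv DM DM_rel \<and>
    (\<exists>F. bij_betw F (ly_complement_classes scale E br tri g) (DM // DM_rel)) \<and>
    (factorization_index scale E br tri g, card_of (DM // DM_rel)) \<in> ordIso"
proof -
  interpret A: lie_yamaguti_algebra scale E br tri by fact
  interpret MP: ly_matched_pair scale g br tri scale h br tri \<rho> \<mu> \<psi> \<nu>
    using assms by (simp add: canonical_matched_pair_def)
  interpret P: canonical_pair scale E br tri g h \<rho> \<mu> \<psi> \<nu>
    using assms(5,6)
    by unfold_locales (auto simp: canonical_matched_pair_def ly_strong_complement_def)
  have iso: "equiv {k. ly_complement scale E br tri g k} (ly_complement_iso scale E br tri g)"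
    by (rule equiv_ly_complement_iso) unfold_locales
  note pullback = equiv_pullback_bij[OF iso P.bij_graph P.deformation_rel_pullback]
  have "equiv DM DM_rel"
    unfolding DM_def DM_rel_def by (rule pullback(1))
  \<comment> \<open>The witness sends a class of complements to the set of deformation maps whose
    graphs belong to it; the same bijection yields the equality of cardinals.\<close>
  moreover have bij: "bij_betw (\<lambda>X. P.graph -` X \<inter> DM)
      (ly_complement_classes scale E br tri g) (DM // DM_rel)"
    unfolding DM_def DM_rel_def ly_complement_classes_def by (rule pullback(2))
  moreover have "(factorization_index scale E br tri g, card_of (DM // DM_rel)) \<in> ordIso"
    unfolding factorization_index_def using bij by (rule card_of_ordIsoI)
  ultimately show ?thesis by (intro conjI exI)
qed

end
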